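(* For each $t\in\mathbb{N}$, let $\mathcal{D}_t$ be a bounded sequence of integers each greater than or equal to $2$, and let $(i_t,j_t)$ be a pair of real numbers with $0<i_t,j_t<1$ and $i_t+j_t=1$. Then $$\dim\Big(\bigcap_{t=1}^\infty \mathbf{Bad}_{\mathcal{D}_t}(i_t,j_t)\Big)=1,$$ where $\dim$ denotes Hausdorff dimension and, for each $t$, $$\mathbf{Bad}_{\mathcal{D}_t}(i_t,j_t)=\Big\{x\in\mathbb{R} : \exists\, c(x)>0 \text{ such that } \max\{|q|_{\mathcal{D}_t}^{1/i_t},\ \|qx\|^{1/j_t}\}>\frac{c(x)}{q}\quad \forall\, q\in\mathbb{N}\Big\}.$$
   Context: Here $\mathbb{N}=\{1,2,3,\dots\}$ and $\|y\|$ denotes the distance from $y\in\mathbb{R}$ to the nearest integer. The $\mathcal{D}$-norm: for a bounded sequence $\mathcal{D}=(d_n)_{n=1}^\infty$ of integers $d_n\ge 2$, put $D_0:=1$ and $D_n:=\prod_{k=1}^n d_k$ for $n\ge1$. For $q\in\mathbb{N}$ let $\omega_{\mathcal{D}}(q):=\sup\{n\ge 0 : q\in D_n\mathbb{Z}\}$ and $|q|_{\mathcal{D}}:=1/D_{\omega_{\mathcal{D}}(q)}=\inf\{1/D_n : n\ge 0,\ q\in D_n\mathbb{Z}\}$. *)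

theory Defs
  imports "HOL-Analysis.Analysis"
begin

subsection \<open>Hausdorff dimension\<close>

text \<open>
  The weight \<open>(diam U)\<^sup>s\<close> of a covering set. Two conventions are spelled out because
  \<open>0 powr 0 = 0\<close> here: the empty set has weight \<open>0\<close>, and every nonempty set has weight \<open>1\<close>
  when \<open>s = 0\<close>, so that the case \<open>s = 0\<close> gives counting measure.
\<close>

definition diam_powr :: "real \<Rightarrow> 'a::metric_space set \<Rightarrow> real" where
  "diam_powr s U = (if U = {} then 0 else if s = 0 then 1 else diameter U powr s)"

text \<open>
  Covering sets are required to be bounded because \<^const>\<open>diameter\<close> is meaningless on
  unbounded sets. Finite covers are included, since the \<open>U n\<close> may be empty.
\<close>

definition hausdorff_premeasure :: "real \<Rightarrow> real \<Rightarrow> 'a::metric_space set \<Rightarrow> ennreal" where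
  "hausdorff_premeasure s \<delta> A =
     (INF U \<in> {U :: nat \<Rightarrow> 'a set. A \<subseteq> (\<Union>n. U n) \<and> (\<forall>n. bounded (U n) \<and> diameter (U n) \<le> \<delta>)}.
        \<Sum>n. ennreal (diam_powr s (U n)))"

definition hausdorff_measure :: "real \<Rightarrow> 'a::metric_space set \<Rightarrow> ennreal" where
  "hausdorff_measure s A = (SUP \<delta>\<in>{0<..}. hausdorff_premeasure s \<delta> A)"

definition hausdorff_dim :: "'a::metric_space set \<Rightarrow> ennreal" where
  "hausdorff_dim A = (INF s \<in> {s. 0 \<le> s \<and> hausdorff_measure s A = 0}. ennreal s)"

subsection \<open>The \<open>\<D>\<close>-norm and mixed badly approximable numbers\<close>

text \<open>
  A sequence \<open>(d\<^sub>n)\<close> with \<open>n \<ge> 1\<close> is a function on \<^typ>\<open>nat\<close> whose value at \<open>0\<close> is never used.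
\<close>

definition Dprod :: "(nat \<Rightarrow> nat) \<Rightarrow> nat \<Rightarrow> nat" where
  "Dprod d n = (\<Prod>k=1..n. d k)"

text \<open>
  When \<open>q \<ge> 1\<close> and all \<open>d k \<ge> 2\<close>, the set below is finite and contains \<open>0\<close>, so the supremum
  in \<^typ>\<open>nat\<close> is a maximum.
\<close>

definition Domega :: "(nat \<Rightarrow> nat) \<Rightarrow> nat \<Rightarrow> nat" where
  "Domega d q = Sup {n. Dprod d n dvd q}"

definition Dnorm :: "(nat \<Rightarrow> nat) \<Rightarrow> nat \<Rightarrow> real" where
  "Dnorm d q = 1 / real (Dprod d (Domega d q))"

text \<open>The distance from \<open>y\<close> to the nearest integer is \<open>infdist y \<int>\<close>.\<close>

definition Bad :: "(nat \<Rightarrow> nat) \<Rightarrow> real \<Rightarrow> real \<Rightarrow> real set" where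
  "Bad d i j = {x. \<exists>c>0. \<forall>q::nat. q \<ge> 1 \<longrightarrow>
     max (Dnorm d q powr (1 / i)) (infdist (real q * x) \<int> powr (1 / j)) > c / real q}"

end

theory Submission
  imports Defs "HOL-Computational_Algebra.Factorial_Ring"
begin

text \<open>
  For one index, \<open>x\<close> fails to be in the set with constant \<open>c\<close> if it lies within
  \<open>c powr j / q powr (1 + j)\<close> of some \<open>p / q\<close> with small norm of \<open>q\<close>. Since the
  products \<open>Dprod d n\<close> divide one another, two such denominators have a large common factor,
  so rationals of comparable height \<open>q powr (1 + j)\<close> are separated by more than their radius
  by a factor of order \<open>1 / c\<close>. For \<open>c\<close> small, an interval of length \<open>1 / R ^ n\<close> thus meets
  the neighbourhood of at most one rational from the relevant window of heights, and avoiding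
  it costs at most \<open>3\<close> of the \<open>R\<close> subintervals. All indices are interleaved in one Cantor
  construction with \<open>R - 3\<close> children per cell, and its dimension tends to \<open>1\<close> as \<open>R\<close> grows.
\<close>

section \<open>Elementary facts about real powers\<close>

lemma powr_le_swap:
  fixes a b e :: real
  assumes "0 \<le> a" "0 < e" "a powr (1 / e) \<le> b"
  shows "a \<le> b powr e"
proof -
  have "(a powr (1/e)) powr e \<le> b powr e"
    using assms by (intro powr_mono2) auto
  thus ?thesis using assms by (simp add: powr_powr)
qed

lemma ex_power_interval:
  fixes b y :: real
  assumes "1 < b" "1 \<le> y"
  shows "\<exists>n::nat. b ^ n \<le> y \<and> y < b ^ Suc n"
proof -
  obtain N where N: "y < b ^ N" using assms real_arch_pow by blast
  define n where "n = (LEAST n. y < b ^ n)"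
  have 1: "y < b ^ n" unfolding n_def by (rule LeastI) (rule N)
  then have "n \<noteq> 0" using assms by (intro notI) simp
  then obtain m where m: "n = Suc m" by (cases n) auto
  have "\<not> y < b ^ m" using not_less_Least[of m "\<lambda>n. y < b ^ n"] m n_def by auto
  then show ?thesis using 1 m by force
qed

subsection \<open>Separation of the dangerous rationals\<close>

lemma Dprod_dvd_Dprod: "m \<le> n \<Longrightarrow> Dprod d m dvd Dprod d n"
  unfolding Dprod_def by (rule prod_dvd_prod_subset) auto

lemma Dprod_ge_power:
  assumes "\<And>n. n \<ge> 1 \<Longrightarrow> d n \<ge> 2"
  shows "2 ^ n \<le> Dprod d n"
proof -
  have "(\<Prod>k=1..n. 2) \<le> (\<Prod>k=1..n. d k)"
    by (rule prod_mono) (use assms in auto)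
  thus ?thesis by (simp add: Dprod_def)
qed

lemma Dprod_Domega_dvd:
  assumes "\<And>n. n \<ge> 1 \<Longrightarrow> d n \<ge> 2" "q \<ge> 1"
  shows "Dprod d (Domega d q) dvd q"
proof -
  let ?A = "{n. Dprod d n dvd q}"
  have "n \<le> q" if "Dprod d n dvd q" for n
  proof -
    have "n < 2 ^ n" by (rule less_exp)
    also have "\<dots> \<le> Dprod d n" using Dprod_ge_power assms(1) .
    also have "\<dots> \<le> q" using that assms(2) by (auto dest: dvd_imp_le)
    finally show ?thesis by simp
  qed
  then have "finite ?A" by (auto intro: finite_subset[of _ "{..q}"])
  moreover have "0 \<in> ?A" by (simp add: Dprod_def)
  ultimately have "Sup ?A \<in> ?A"
    using Max_in[of ?A] by (auto simp: Sup_nat_def)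
  thus ?thesis by (simp add: Domega_def)
qed

text \<open>The difference of the fractions has numerator \<open>p * q' - p' * q\<close>, a nonzero
  multiple of \<open>g\<close>, hence of size at least \<open>g\<close> and not merely at least
  \<open>1\<close>.\<close>

lemma fraction_separation:
  fixes q q' g :: nat and p p' :: int
  assumes "g dvd q" "g dvd q'" "q \<ge> 1" "q' \<ge> 1" "real_of_int p / q \<noteq> real_of_int p' / q'"
  shows "real g / (real q * real q') \<le> \<bar>real_of_int p / q - real_of_int p' / q'\<bar>"
proof -
  let ?m = "p * int q' - p' * int q"
  have "int g dvd ?m" using assms(1,2) by (intro dvd_diff dvd_mult) auto
  moreover have eq: "real_of_int p / q - real_of_int p' / q' = real_of_int ?m / (real q * real q')"
    using assms(3,4) by (simp add: field_simps)
  then have "?m \<noteq> 0" using assms(5) by (metis diff_eq_diff_eq diff_self div_0 of_int_0)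
  ultimately have "int g \<le> \<bar>?m\<bar>" using zdvd_imp_le[of "int g" "\<bar>?m\<bar>"] by auto
  then have "real g \<le> \<bar>real_of_int ?m\<bar>" by linarith
  then show ?thesis unfolding eq by (simp add: abs_div divide_right_mono)
qed

text \<open>Windows are cut in terms of \<open>q powr (1 + j)\<close> because the neighbourhood of
  \<open>p / q\<close> has radius \<open>c powr j / q powr (1 + j)\<close>. They are half-open so
  that consecutive ones tile, and the last inequality is the exact negation of the one in
  \<open>Bad\<close>.\<close>

definition danger :: "(nat \<Rightarrow> nat) \<Rightarrow> real \<Rightarrow> real \<Rightarrow> real \<Rightarrow> real \<Rightarrow> real \<Rightarrow> real set" where
  "danger d i j c lo hi = {x. \<exists>q::nat. q \<ge> 1 \<and> lo \<le> real q powr (1 + j) \<and> real q powr (1 + j) < hi \<and>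
     max (Dnorm d q powr (1 / i)) (infdist (real q * x) \<int> powr (1 / j)) \<le> c / real q}"

text \<open>Stripping the exponents \<open>1 / i\<close> and \<open>1 / j\<close> bounds both norms
  by powers of \<open>c / q\<close>. With \<open>p\<close> the integer nearest to
  \<open>q * x\<close>, division by \<open>q\<close> turns \<open>(c / q) powr j\<close> into the
  radius, which is largest at the lower end \<open>lo\<close> of the window.\<close>

lemma danger_witness:
  assumes "x \<in> danger d i j c lo hi" "0 < i" "0 < j" "0 < c" "0 < lo"
  obtains p :: int and q :: nat where "q \<ge> 1" "real q powr (1 + j) < hi"
    "Dnorm d q \<le> (c / q) powr i" "\<bar>x - p / q\<bar> \<le> c powr j / lo"
proof -
  obtain q :: nat where q: "q \<ge> 1" "lo \<le> real q powr (1 + j)" "real q powr (1 + j) < hi"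
    "Dnorm d q powr (1 / i) \<le> c / q" "infdist (real q * x) \<int> powr (1 / j) \<le> c / q"
    using assms(1) by (auto simp: danger_def)
  have 1: "Dnorm d q \<le> (c / q) powr i"
    by (rule powr_le_swap[OF _ assms(2) q(4)]) (simp add: Dnorm_def)
  have 2: "infdist (real q * x) \<int> \<le> (c / q) powr j"
    by (rule powr_le_swap[OF infdist_nonneg assms(3) q(5)])
  have "closed (\<int> :: real set)" "(\<int> :: real set) \<noteq> {}" by auto
  then obtain y where y: "y \<in> \<int>" "infdist (real q * x) \<int> = dist (real q * x) y"
    using infdist_attains_inf by metis
  then obtain p :: int where p: "y = p" by (auto elim: Ints_cases)
  have "\<bar>x - p / q\<bar> = \<bar>q * x - p\<bar> / q"
  proof -
    have "x - p / q = (q * x - p) / q" using q by (simp add: field_simps)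
    then show ?thesis by (simp add: abs_div)
  qed
  also have "\<dots> \<le> (c / q) powr j / q"
    using 2 y p by (intro divide_right_mono) (auto simp: dist_real_def)
  also have "\<dots> = c powr j / real q powr (1 + j)"
    using q assms by (simp add: powr_divide powr_add)
  also have "\<dots> \<le> c powr j / lo"
    using q assms by (intro divide_left_mono) auto
  finally show ?thesis using that q 1 by blast
qed

text \<open>
  If both norms are small, the denominators share a factor of size at least
  \<open>(min q q' / c) powr i\<close>; hence two distinct rationals that endanger points of the
  interval would be too far apart.
\<close>
lemma danger_localized:
  assumes d: "\<And>n. n \<ge> 1 \<Longrightarrow> d n \<ge> 2"
    and ij: "0 < i" "i < 1" "0 < j" "i + j = 1" and c: "0 < c" and lo: "0 < lo" and hi: "0 < hi"
    and len: "l + 2 * (c powr j / lo) \<le> c powr (- i) / hi"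
  shows "\<exists>z. \<forall>x \<in> danger d i j c lo hi \<inter> {a..a+l}. \<bar>x - z\<bar> \<le> c powr j / lo"
proof (cases "danger d i j c lo hi \<inter> {a..a+l} = {}")
  case True
  then show ?thesis by blast
next
  case False
  then obtain x where x: "x \<in> danger d i j c lo hi" "x \<in> {a..a+l}" by blast
  obtain p :: int and q :: nat where q: "q \<ge> 1" "real q powr (1 + j) < hi"
    "Dnorm d q \<le> (c / q) powr i" "\<bar>x - p / q\<bar> \<le> c powr j / lo"
    using danger_witness[OF x(1) ij(1,3) c lo] .
  show ?thesis
  \<comment> \<open>The fraction of one arbitrary endangered point serves as centre; every other
    endangered point of the interval turns out to have the same fraction.\<close>
  proof (intro exI[of _ "p / q"] ballI)
    fix x' assume x': "x' \<in> danger d i j c lo hi \<inter> {a..a+l}"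
    obtain p' :: int and q' :: nat where q': "q' \<ge> 1" "real q' powr (1 + j) < hi"
      "Dnorm d q' \<le> (c / q') powr i" "\<bar>x' - p' / q'\<bar> \<le> c powr j / lo"
      using danger_witness[OF IntD1[OF x'] ij(1,3) c lo] .
    have "real_of_int p / q = real_of_int p' / q'"
    proof (rule ccontr)
      assume ne: "\<not> ?thesis"
      \<comment> \<open>The products are nested, so the one with the smaller index divides both
        denominators. It is large because both norms are small.\<close>
      define w where "w = min (Domega d q) (Domega d q')"
      define g where "g = Dprod d w"
      define m M where "m = min q q'" and "M = max q q'"
      have dv: "g dvd q" "g dvd q'"
        using Dprod_Domega_dvd[of d, OF d] q(1) q'(1) Dprod_dvd_Dprod[of w _ d]
        unfolding g_def w_def by (meson dvd_trans min.cobounded1 min.cobounded2)+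
      have norm_le: "(real r / c) powr i \<le> Dprod d (Domega d r)"
        if "r \<ge> 1" "Dnorm d r \<le> (c / r) powr i" for r
      proof -
        have "0 < real (Dprod d (Domega d r))"
          using Dprod_ge_power[of d "Domega d r", OF d] by (simp add: less_le_trans[of 0 "2 ^ _"])
        then show ?thesis
          using that c by (simp add: Dnorm_def powr_divide field_simps)
      qed
      have mono: "(real m / c) powr i \<le> (real r / c) powr i" if "m \<le> r" for r
        using that ij c by (intro powr_mono2 divide_right_mono) auto
      have g_ge: "(real m / c) powr i \<le> g"
        using norm_le[OF q(1,3)] norm_le[OF q'(1,3)] mono[of q] mono[of q']
        unfolding g_def w_def m_def min_def by (auto split: if_splits)
      have mM: "m \<ge> 1" "m \<le> M" "real q * real q' = real m * real M" "real M powr (1 + j) < hi"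
        using q q' by (auto simp: m_def M_def min_def max_def)
      \<comment> \<open>As \<open>1 + j = (1 - i) + 1\<close> and \<open>i - 1 < 0\<close>, one
        factor \<open>M powr (i - 1)\<close> can be traded for the larger
        \<open>m powr (i - 1)\<close>. This leaves \<open>(m / c) powr i / (m * M)\<close>, which
        \<open>g_ge\<close> compares with the separation of the two fractions.\<close>
      have "c powr (- i) / hi < c powr (- i) / real M powr (1 + j)"
        using mM c hi by (intro divide_strict_left_mono) auto
      also have "\<dots> = c powr (- i) * (real M powr (i - 1) / M)"
      proof -
        have "real M powr (1 + j) = real M powr (1 - i) * M"
        proof -
          have j: "1 + j = (1 - i) + 1" using ij by simp
          show ?thesis unfolding j powr_add using mM by simp
        qed
        then show ?thesis
          using mM powr_minus[of "real M" "1 - i"] by (simp add: divide_simps)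
      qed
      also have "\<dots> \<le> c powr (- i) * (real m powr (i - 1) / M)"
        using mM ij by (intro mult_left_mono divide_right_mono powr_mono2') auto
      also have "\<dots> = (real m / c) powr i / (m * M)"
        using mM c by (simp add: powr_divide powr_diff powr_minus field_simps)
      also have "\<dots> \<le> real g / (real q * real q')"
        unfolding mM using g_ge by (simp add: divide_right_mono)
      also have "\<dots> \<le> \<bar>real_of_int p / q - real_of_int p' / q'\<bar>"
        using fraction_separation dv q(1) q'(1) ne by blast
      also have "\<dots> \<le> l + 2 * (c powr j / lo)"
        using x x' q(4) q'(4) by auto
      finally show False using len by simp
    qed
    then show "\<bar>x' - p / q\<bar> \<le> c powr j / lo" using q'(4) by simp
  qed
qed

subsection \<open>Hausdorff dimension on the line\<close>

lemma hausdorff_premeasure_le: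
  assumes "A \<subseteq> (\<Union>n. U n)" "\<And>n. bounded (U n)" "\<And>n. diameter (U n) \<le> \<delta>"
  shows "hausdorff_premeasure s \<delta> A \<le> (\<Sum>n. ennreal (diam_powr s (U n)))"
  unfolding hausdorff_premeasure_def using assms by (intro INF_lower) auto

text \<open>Divergence of the harmonic series: intervals of lengths \<open>1, 1/2, 1/3, ...\<close>
  laid end to end cover the half-line.\<close>

lemma harmonic_interval:
  fixes y :: real
  assumes "0 \<le> y"
  shows "\<exists>n. (\<Sum>k<n. 1 / real (Suc k)) \<le> y \<and> y \<le> (\<Sum>k<Suc n. 1 / real (Suc k))"
proof -
  let ?H = "\<lambda>n. \<Sum>k<n. 1 / real (Suc k)"
  have "\<not> summable (\<lambda>k. 1 / real (Suc k))"
    using not_summable_harmonic[where 'a=real] summable_Suc_iff[of "\<lambda>k. inverse (real k)"] by (simp add: inverse_eq_divide)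
  then have "\<exists>n. y < ?H n"
    using bounded_imp_summable[of "\<lambda>k. 1 / real (Suc k)" y]
    by (metis lessThan_Suc_atMost not_le of_nat_0_le_iff zero_le_divide_1_iff)
  define n where "n = (LEAST n. y < ?H n)"
  have 1: "y < ?H n" unfolding n_def by (rule LeastI_ex) fact
  then have "n \<noteq> 0" using assms by (intro notI) simp
  then obtain m where m: "n = Suc m" by (cases n) auto
  have "\<not> y < ?H m" using not_less_Least[of m "\<lambda>n. y < ?H n"] m n_def by auto
  then show ?thesis using 1 m by (intro exI[of _ m]) auto
qed

text \<open>Intervals of lengths \<open>\<epsilon> / n\<close> cover the whole line at once, because
  the harmonic series diverges, while their weights have a finite sum for \<open>s > 1\<close>. That
  sum scales like \<open>\<epsilon> powr s\<close> and tends to \<open>0\<close>.\<close>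

lemma hausdorff_premeasure_real_eq_0:
  fixes A :: "real set"
  assumes "1 < s" "0 < \<delta>"
  shows "hausdorff_premeasure s \<delta> A = 0"
proof -
  let ?H = "\<lambda>n. \<Sum>k<n. 1 / real (Suc k)"
  define Z where "Z = (\<Sum>n. 1 / real (Suc n) powr s)"
  have summ: "summable (\<lambda>n. 1 / real (Suc n) powr s)"
  proof -
    have "summable (\<lambda>n. real n powr (- s))" using assms by (simp add: summable_real_powr_iff)
    then have "summable (\<lambda>n. real (Suc n) powr (- s))" by (subst summable_Suc_iff)
    then show ?thesis by (simp add: powr_minus_divide)
  qed
  have le: "hausdorff_premeasure s \<delta> A \<le> ennreal ((2 * \<epsilon>) powr s * Z)" if \<epsilon>: "0 < \<epsilon>" "\<epsilon> \<le> \<delta>" for \<epsilon>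
  proof -
    \<comment> \<open>Even indices cover the nonnegative half-line, odd ones are their mirror
      images. Each length is thus used twice, which the factor \<open>2\<close> in
      \<open>2 * \<epsilon>\<close> below absorbs.\<close>
    define U where "U = (\<lambda>n. let m = n div 2; I = {\<epsilon> * ?H m..\<epsilon> * ?H (Suc m)} in if even n then I else uminus ` I)"
    have diam: "diameter (U n) = \<epsilon> / real (Suc (n div 2))" for n
    proof -
      have 1: "\<epsilon> * ?H m \<le> \<epsilon> * ?H (Suc m)" for m using \<epsilon> by (intro mult_left_mono) auto
      have 2: "\<epsilon> * ?H (Suc m) - \<epsilon> * ?H m = \<epsilon> / real (Suc m)" for m by (simp add: distrib_left)
      show ?thesis unfolding U_def Let_def using 1[of "n div 2"] 2[of "n div 2"]
        by (simp del: sum.lessThan_Suc)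
    qed
    have "A \<subseteq> (\<Union>n. U n)"
    proof
      fix x :: real
      obtain m where m: "?H m \<le> \<bar>x\<bar> / \<epsilon>" "\<bar>x\<bar> / \<epsilon> \<le> ?H (Suc m)"
        using harmonic_interval[of "\<bar>x\<bar> / \<epsilon>"] \<epsilon> by auto
      then have I: "\<bar>x\<bar> \<in> {\<epsilon> * ?H m..\<epsilon> * ?H (Suc m)}"
        using \<epsilon> by (simp add: pos_le_divide_eq pos_divide_le_eq mult.commute del: sum.lessThan_Suc)
      show "x \<in> (\<Union>n. U n)"
      proof (cases "x \<ge> 0")
        case True
        then have "x \<in> U (2 * m)" using I by (simp add: U_def del: sum.lessThan_Suc)
        then show ?thesis by blast
      next
        case False
        then have "x \<in> U (2 * m + 1)" using I by (simp add: U_def del: sum.lessThan_Suc)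
        then show ?thesis by blast
      qed
    qed
    moreover have "bounded (U n)" for n by (simp add: U_def Let_def)
    moreover have "diameter (U n) \<le> \<delta>" for n
    proof -
      have "\<epsilon> / real (Suc (n div 2)) \<le> \<epsilon> / 1" using \<epsilon> by (intro divide_left_mono) auto
      then show ?thesis using \<epsilon> by (simp add: diam)
    qed
    ultimately have "hausdorff_premeasure s \<delta> A \<le> (\<Sum>n. ennreal (diam_powr s (U n)))"
      by (rule hausdorff_premeasure_le)
    also have "\<dots> \<le> (\<Sum>n. ennreal ((2 * \<epsilon>) powr s * (1 / real (Suc n) powr s)))"
    proof (intro suminf_le ennreal_leI)
      fix n
      have "Suc n \<le> 2 * Suc (n div 2)" by presburger
      then have "real (Suc n) \<le> 2 * real (Suc (n div 2))" by (metis of_nat_le_iff of_nat_mult of_nat_numeral)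
      then have "\<epsilon> * real (Suc n) \<le> \<epsilon> * (2 * real (Suc (n div 2)))" using \<epsilon> by (intro mult_left_mono) auto
      then have "\<epsilon> / real (Suc (n div 2)) \<le> 2 * \<epsilon> / real (Suc n)"
        by (simp add: divide_simps mult.commute mult.left_commute del: of_nat_Suc)
      then have "diameter (U n) powr s \<le> (2 * \<epsilon> / real (Suc n)) powr s"
        unfolding diam using assms \<epsilon> by (intro powr_mono2) auto
      then show "diam_powr s (U n) \<le> (2 * \<epsilon>) powr s * (1 / real (Suc n) powr s)"
        using assms \<epsilon> by (auto simp: diam_powr_def powr_divide)
    qed auto
    also have "\<dots> = ennreal ((2 * \<epsilon>) powr s * Z)"
    proof -
      have "summable (\<lambda>n. (2 * \<epsilon>) powr s * (1 / real (Suc n) powr s))" by (rule summable_mult[OF summ])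
      then have "(\<Sum>n. ennreal ((2 * \<epsilon>) powr s * (1 / real (Suc n) powr s)))
          = ennreal (\<Sum>n. (2 * \<epsilon>) powr s * (1 / real (Suc n) powr s))"
        by (intro suminf_ennreal2) auto
      also have "(\<Sum>n. (2 * \<epsilon>) powr s * (1 / real (Suc n) powr s)) = (2 * \<epsilon>) powr s * Z"
        unfolding Z_def by (rule suminf_mult[OF summ])
      finally show ?thesis .
    qed
    finally show ?thesis .
  qed
  have "((\<lambda>\<epsilon>. (2 * \<epsilon>) powr s * Z) \<longlongrightarrow> 0 * Z) (at_right 0)"
  proof (rule tendsto_mult)
    have "((\<lambda>\<epsilon>. (2 * \<epsilon>) powr s) \<longlongrightarrow> (2 * 0) powr s) (at_right (0::real))"
      using assms by (intro tendsto_powr' tendsto_intros) (auto simp: eventually_at_right_less intro!: eventually_at_rightI[of 0 1])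
    then show "((\<lambda>\<epsilon>. (2 * \<epsilon>) powr s) \<longlongrightarrow> 0) (at_right (0::real))" by simp
  qed simp
  then have "((\<lambda>\<epsilon>. ennreal ((2 * \<epsilon>) powr s * Z)) \<longlongrightarrow> ennreal 0) (at_right 0)"
    by (intro tendsto_ennrealI) simp
  moreover have "\<forall>\<^sub>F \<epsilon> in at_right 0. hausdorff_premeasure s \<delta> A \<le> ennreal ((2 * \<epsilon>) powr s * Z)"
    using le assms by (intro eventually_at_rightI[of 0 \<delta>]) auto
  ultimately have "hausdorff_premeasure s \<delta> A \<le> ennreal 0"
    by (rule tendsto_lowerbound) simp
  then show ?thesis by simp
qed

lemma hausdorff_dim_real_le_1: "hausdorff_dim (A :: real set) \<le> 1"
proof -
  have "hausdorff_dim A \<le> ennreal s" if "1 < s" for s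
    unfolding hausdorff_dim_def using that hausdorff_premeasure_real_eq_0[of s _ A]
    by (intro INF_lower) (auto simp: hausdorff_measure_def)
  then have "\<forall>\<^sub>F s in at_right 1. hausdorff_dim A \<le> ennreal s"
    by (intro eventually_at_rightI[of 1 2]) auto
  moreover have "((\<lambda>s. ennreal s) \<longlongrightarrow> ennreal 1) (at_right 1)"
    by (intro tendsto_ennrealI tendsto_ident_at)
  ultimately have "hausdorff_dim A \<le> ennreal 1" by (intro tendsto_lowerbound) auto
  then show ?thesis by simp
qed

text \<open>For covering sets of diameter at most \<open>1\<close> the weight decreases in the
  exponent, so positivity at a single scale \<open>\<delta> \<le> 1\<close> rules out a vanishing
  measure for every smaller exponent.\<close>

lemma hausdorff_dim_ge:
  assumes pos: "\<And>s. s < a \<Longrightarrow> 0 < s \<Longrightarrow> \<exists>\<delta>. 0 < \<delta> \<and> \<delta> \<le> 1 \<and> 0 < hausdorff_premeasure s \<delta> A" and "0 < a"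
  shows "ennreal a \<le> hausdorff_dim A"
  unfolding hausdorff_dim_def
proof (intro INF_greatest ennreal_leI)
  fix s assume "s \<in> {s. 0 \<le> s \<and> hausdorff_measure s A = 0}"
  then have s: "0 \<le> s" "hausdorff_measure s A = 0" by auto
  show "a \<le> s"
  proof (rule ccontr)
    assume "\<not> a \<le> s"
    \<comment> \<open>The hypothesis speaks only of positive exponents, so \<open>s = 0\<close> is
      compared with a positive exponent below \<open>a\<close>.\<close>
    define s' where "s' = (if s = 0 then a / 2 else s)"
    have s': "0 < s'" "s' < a" "s \<le> s'" using s \<open>\<not> a \<le> s\<close> \<open>0 < a\<close> by (auto simp: s'_def)
    then obtain \<delta> where \<delta>: "0 < \<delta>" "\<delta> \<le> 1" "0 < hausdorff_premeasure s' \<delta> A" using pos by blast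
    have "diam_powr s' U \<le> diam_powr s U" if "bounded U" "diameter U \<le> \<delta>" for U :: "'a set"
      using that \<delta> s' s diameter_ge_0[of U] 
      by (auto simp: diam_powr_def powr_le1 intro!: powr_mono')
    then have "hausdorff_premeasure s' \<delta> A \<le> hausdorff_premeasure s \<delta> A"
      unfolding hausdorff_premeasure_def
      by (intro INF_mono) (auto intro!: suminf_le ennreal_leI)
    also have "\<dots> \<le> hausdorff_measure s A"
      unfolding hausdorff_measure_def using \<delta> by (intro SUP_upper) auto
    finally show False using s \<delta> by simp
  qed
qed

subsection \<open>Cantor sets\<close>

text \<open>\<open>S n\<close> indexes the surviving closed cells \<open>[k / R ^ n, (k + 1) / R ^ n]\<close> of level \<open>n\<close>.\<close>
locale cantor_tree =
  fixes R M :: nat and S :: "nat \<Rightarrow> nat set" and C :: "nat \<Rightarrow> nat \<Rightarrow> nat set"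
  assumes R: "R \<ge> 2" and M: "M \<ge> 1"
    and S_0: "S 0 = {0}" and S_Suc: "S (Suc n) = (\<Union>k\<in>S n. C n k)"
    and C_sub: "k \<in> S n \<Longrightarrow> C n k \<subseteq> {R * k..<R * k + R}"
    and C_card: "k \<in> S n \<Longrightarrow> card (C n k) = M"
begin

definition cell :: "nat \<Rightarrow> nat \<Rightarrow> real set" where
  "cell n k = {real k / R ^ n..(real k + 1) / R ^ n}"

definition level :: "nat \<Rightarrow> real set" where
  "level n = (\<Union>k\<in>S n. cell n k)"

definition limit_set :: "real set" where
  "limit_set = (\<Inter>n. level n)"

lemma finite_S: "finite (S n)"
proof (induction n)
  case (Suc n)
  then show ?case unfolding S_Suc using C_sub by (meson finite_UN_I finite_atLeastLessThan finite_subset)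
qed (simp add: S_0)

lemma C_div: "k \<in> S n \<Longrightarrow> l \<in> C n k \<Longrightarrow> l div R = k"
  using C_sub[of k n] R by (auto intro!: div_nat_eqI simp: algebra_simps)

lemma finite_C: "k \<in> S n \<Longrightarrow> finite (C n k)"
  using C_sub by (meson finite_atLeastLessThan finite_subset)

lemma card_S: "card (S n) = M ^ n"
proof (induction n)
  case (Suc n)
  have "card (S (Suc n)) = (\<Sum>k\<in>S n. card (C n k))"
    unfolding S_Suc using finite_S finite_C
  proof (intro card_UN_disjoint ballI impI)
    fix k k' assume "k \<in> S n" "k' \<in> S n" "k \<noteq> k'"
    then show "C n k \<inter> C n k' = {}" using C_div by blast
  qed
  also have "\<dots> = M ^ Suc n" using C_card Suc by simp
  finally show ?case .
qed (simp add: S_0)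

text \<open>An index records its ancestry: by \<open>C_div\<close>, \<open>l div R ^ p\<close> is
  the ancestor \<open>p\<close> levels up, and each level multiplies the count by at most
  \<open>M\<close>.\<close>

lemma card_descendants: "card {l \<in> S (m + p). l div R ^ p = k} \<le> M ^ p"
proof (induction p)
  case 0
  have "{l \<in> S (m + 0). l div R ^ 0 = k} \<subseteq> {k}" by auto
  then show ?case using card_mono[of "{k}"] by fastforce
next
  case (Suc p)
  let ?D = "{l \<in> S (m + p). l div R ^ p = k}"
  have "{l \<in> S (m + Suc p). l div R ^ Suc p = k} \<subseteq> (\<Union>k'\<in>?D. C (m + p) k')"
    using C_div by (auto simp: S_Suc div_mult2_eq)
  then have "card {l \<in> S (m + Suc p). l div R ^ Suc p = k} \<le> card (\<Union>k'\<in>?D. C (m + p) k')"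
    using finite_S finite_C by (intro card_mono) auto
  also have "\<dots> \<le> (\<Sum>k'\<in>?D. card (C (m + p) k'))" using finite_S by (intro card_UN_le) auto
  also have "\<dots> = M * card ?D" using C_card by simp
  also have "\<dots> \<le> M ^ Suc p" using Suc by simp
  finally show ?case .
qed

lemma cell_subset: "k \<in> S n \<Longrightarrow> l \<in> C n k \<Longrightarrow> cell (Suc n) l \<subseteq> cell n k"
proof -
  assume "k \<in> S n" "l \<in> C n k"
  then have "R * k \<le> l" "l + 1 \<le> R * (k + 1)" using C_sub[of k n] by auto
  then have "real (R * k) \<le> real l" "real (l + 1) \<le> real (R * (k + 1))" by (simp_all only: of_nat_le_iff)
  then have "real k / R ^ n \<le> real l / R ^ Suc n" "(real l + 1) / R ^ Suc n \<le> (real k + 1) / R ^ n"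
    using R mult_right_mono[of "1 + real l" "real R + real R * real k" "real R ^ n"]
    by (simp_all add: field_simps)
  then show ?thesis by (auto simp: cell_def)
qed

lemma level_decseq: "m \<le> n \<Longrightarrow> level n \<subseteq> level m"
proof (induction rule: dec_induct)
  case (step n)
  have "level (Suc n) \<subseteq> level n" using cell_subset by (fastforce simp: level_def S_Suc)
  then show ?case using step by blast
qed auto

lemma closed_level: "closed (level n)"
  unfolding level_def cell_def using finite_S by (intro closed_UN) auto

text \<open>Left endpoints closer than \<open>1 / R ^ m\<close> have equal or neighbouring ancestors
  at level \<open>m\<close>, so at most three ancestors share the count.\<close>

lemma card_meeting:
  assumes V: "\<And>x y. x \<in> V \<Longrightarrow> y \<in> V \<Longrightarrow> \<bar>x - y\<bar> < \<rho>" and "\<rho> \<le> 1 / R ^ m" and "m \<le> n"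
  shows "card {l \<in> S n. real l / R ^ n \<in> V} \<le> 3 * M ^ (n - m)"
proof (cases "{l \<in> S n. real l / R ^ n \<in> V} = {}")
  case False
  then obtain l\<^sub>0 where l\<^sub>0: "l\<^sub>0 \<in> S n" "real l\<^sub>0 / R ^ n \<in> V" by blast
  define p k\<^sub>0 where "p = n - m" and "k\<^sub>0 = l\<^sub>0 div R ^ p"
  have n: "n = m + p" using assms by (simp add: p_def)
  have Rp: "R ^ p > 0" using R by simp
  \<comment> \<open>For \<open>k\<^sub>0 = 0\<close> the truncated \<open>k\<^sub>0 - 1\<close>
    coincides with \<open>k\<^sub>0\<close>; the upper bound is unaffected.\<close>
  have near: "l div R ^ p \<in> {k\<^sub>0 - 1, k\<^sub>0, k\<^sub>0 + 1}" if "l \<in> S n" "real l / R ^ n \<in> V" for l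
  proof -
    have "\<bar>real l / R ^ n - real l\<^sub>0 / R ^ n\<bar> < 1 / R ^ m"
      using V[OF that(2) l\<^sub>0(2)] assms(2) by simp
    then have "\<bar>real l - real l\<^sub>0\<bar> < real R ^ p"
      using R by (simp add: n power_add field_simps flip: diff_divide_distrib)
    then have "\<bar>int l - int l\<^sub>0\<bar> < int (R ^ p)"
      by (metis (mono_tags, opaque_lifting) of_int_abs of_int_diff of_int_less_iff of_int_of_nat_eq of_nat_power)
    then have 1: "l < l\<^sub>0 + R ^ p" "l\<^sub>0 < l + R ^ p" by linarith+
    then have "l div R ^ p \<le> (l\<^sub>0 + R ^ p) div R ^ p" "l\<^sub>0 div R ^ p \<le> (l + R ^ p) div R ^ p"
      by (auto intro!: div_le_mono)
    then show ?thesis using Rp by (auto simp: k\<^sub>0_def)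
  qed
  let ?D = "\<lambda>k. {l \<in> S (m + p). l div R ^ p = k}"
  have "card {l \<in> S n. real l / R ^ n \<in> V} \<le> card (\<Union>k\<in>{k\<^sub>0 - 1, k\<^sub>0, k\<^sub>0 + 1}. ?D k)"
    using near finite_S by (intro card_mono) (auto simp: n)
  also have "\<dots> \<le> (\<Sum>k\<in>{k\<^sub>0 - 1, k\<^sub>0, k\<^sub>0 + 1}. card (?D k))" by (intro card_UN_le) auto
  also have "\<dots> \<le> (\<Sum>k\<in>{k\<^sub>0 - 1, k\<^sub>0, k\<^sub>0 + 1}. M ^ p)" using card_descendants by (intro sum_mono)
  also have "\<dots> \<le> 3 * M ^ p" by (simp add: card_insert_if)
  finally show ?thesis by (simp add: p_def)
next
  case True
  then show ?thesis by (simp only: card.empty zero_le)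
qed

text \<open>A mass distribution argument by counting: compactness reduces to finitely many sets, and
  at a deep level \<open>N\<close> these must capture all \<open>M ^ N\<close> left endpoints. A set
  of size about \<open>1 / R ^ m\<close> captures at most \<open>3 * M ^ (N - m)\<close>, a share
  controlled by its weight since \<open>R powr s \<le> M\<close>.\<close>

lemma open_cover_bound:
  fixes V :: "nat \<Rightarrow> real set" and \<rho> :: "nat \<Rightarrow> real"
  assumes cov: "limit_set \<subseteq> (\<Union>n. V n)" and op: "\<And>n. open (V n)"
    and \<rho>: "\<And>n. 0 < \<rho> n" "\<And>n. \<rho> n \<le> 1"
    and V: "\<And>n x y. x \<in> V n \<Longrightarrow> y \<in> V n \<Longrightarrow> \<bar>x - y\<bar> < \<rho> n"
    and s: "0 < s" "real R powr s \<le> M"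
  shows "\<exists>I. finite I \<and> 1 \<le> 3 * R powr s * (\<Sum>n\<in>I. \<rho> n powr s)"
proof -
  have "compact (level 0)"
    using closed_level by (simp add: level_def S_0 cell_def)
  \<comment> \<open>A point outside all the complements lies in \<open>limit_set\<close> and so in
    some \<open>V n\<close>; adding the complements allows compactness to be applied to
    \<open>level 0\<close>.\<close>
  moreover have "level 0 \<subseteq> (\<Union>n. V n \<union> - level n)"
    using cov by (auto simp: limit_set_def)
  moreover have "open (V n \<union> - level n)" for n using op closed_level by auto
  ultimately obtain I where I: "finite I" "level 0 \<subseteq> (\<Union>n\<in>I. V n \<union> - level n)"
    using compactE_image[of "level 0" UNIV "\<lambda>n. V n \<union> - level n"] by auto
  have "\<exists>m. real R ^ m \<le> 1 / \<rho> n \<and> 1 / \<rho> n < real R ^ Suc m" for n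
    using \<rho>[of n] R by (intro ex_power_interval) auto
  then obtain \<mu> where \<mu>: "\<And>n. real R ^ \<mu> n \<le> 1 / \<rho> n" "\<And>n. 1 / \<rho> n < real R ^ Suc (\<mu> n)"
    by metis
  \<comment> \<open>\<open>N\<close> bounds \<open>I\<close>, so that points of
    \<open>level N\<close> avoid every complement used, even left endpoints outside
    \<open>limit_set\<close>; it bounds each \<open>\<mu> n\<close>, so that
    \<open>card_meeting\<close> applies.\<close>
  define N where "N = Max (insert 0 (I \<union> \<mu> ` I))"
  have N: "n \<le> N" "\<mu> n \<le> N" if "n \<in> I" for n
    unfolding N_def using I(1) that by (auto intro!: Max_ge)
  have "S N \<subseteq> (\<Union>n\<in>I. {l \<in> S N. real l / R ^ N \<in> V n})"
  proof
    fix l assume l: "l \<in> S N"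
    have "real l / R ^ N \<in> cell N l" by (auto simp: cell_def divide_right_mono)
    then have "real l / R ^ N \<in> level N" using l by (auto simp: level_def)
    then have lev: "real l / R ^ N \<in> level n" if "n \<le> N" for n using level_decseq that by blast
    from lev[of 0] I(2) obtain n where "n \<in> I" "real l / R ^ N \<in> V n \<union> - level n" by blast
    with lev[of n] N(1) have "n \<in> I" "real l / R ^ N \<in> V n" by auto
    then show "l \<in> (\<Union>n\<in>I. {l \<in> S N. real l / R ^ N \<in> V n})" using l by blast
  qed
  then have "card (S N) \<le> card (\<Union>n\<in>I. {l \<in> S N. real l / R ^ N \<in> V n})"
    using I finite_S by (intro card_mono) auto
  also have "\<dots> \<le> (\<Sum>n\<in>I. card {l \<in> S N. real l / R ^ N \<in> V n})" using I by (intro card_UN_le)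
  also have "\<dots> \<le> (\<Sum>n\<in>I. 3 * M ^ (N - \<mu> n))"
  proof (rule sum_mono)
    fix n assume "n \<in> I"
    moreover have "\<rho> n \<le> 1 / real R ^ \<mu> n"
      using \<mu>(1)[of n] \<rho>(1)[of n] R by (simp add: field_simps)
    ultimately show "card {l \<in> S N. real l / R ^ N \<in> V n} \<le> 3 * M ^ (N - \<mu> n)"
      using card_meeting[of "V n" "\<rho> n" "\<mu> n" N] V N by auto
  qed
  finally have "M ^ N \<le> (\<Sum>n\<in>I. 3 * M ^ (N - \<mu> n))" by (simp add: card_S)
  then have "real (M ^ N) \<le> real (\<Sum>n\<in>I. 3 * M ^ (N - \<mu> n))" by (simp only: of_nat_le_iff)
  also have "\<dots> = (\<Sum>n\<in>I. 3 * real M ^ (N - \<mu> n))" by simp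
  also have "\<dots> \<le> (\<Sum>n\<in>I. real M ^ N * (3 * R powr s * \<rho> n powr s))"
  proof (rule sum_mono)
    fix n assume n: "n \<in> I"
    have "1 \<le> \<rho> n * real R ^ Suc (\<mu> n)" using \<mu>(2)[of n] \<rho>(1)[of n] by (simp add: field_simps)
    then have "1 \<le> (\<rho> n * real R ^ Suc (\<mu> n)) powr s" using s by (simp add: ge_one_powr_ge_zero)
    also have "\<dots> = \<rho> n powr s * (R powr s) ^ Suc (\<mu> n)"
      using \<rho>(1)[of n] R by (simp add: powr_mult powr_powr mult.commute flip: powr_realpow del: power_Suc)
    also have "\<dots> = \<rho> n powr s * (R powr s * (R powr s) ^ \<mu> n)" by simp
    also have "\<dots> \<le> \<rho> n powr s * (R powr s * real M ^ \<mu> n)"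
      using s by (intro mult_left_mono power_mono) auto
    finally have "real M ^ (N - \<mu> n) * 1 \<le> real M ^ (N - \<mu> n) * (\<rho> n powr s * (R powr s * real M ^ \<mu> n))"
      by (intro mult_left_mono) auto
    also have "\<dots> = real M ^ (N - \<mu> n + \<mu> n) * (R powr s * \<rho> n powr s)"
      unfolding power_add by (simp add: algebra_simps)
    finally show "3 * real M ^ (N - \<mu> n) \<le> real M ^ N * (3 * R powr s * \<rho> n powr s)"
      using N[OF n] by simp
  qed
  also have "\<dots> = real M ^ N * (3 * R powr s * (\<Sum>n\<in>I. \<rho> n powr s))"
    by (simp add: sum_distrib_left)
  finally have "real M ^ N * 1 \<le> real M ^ N * (3 * R powr s * (\<Sum>n\<in>I. \<rho> n powr s))" by simp
  then have "1 \<le> 3 * R powr s * (\<Sum>n\<in>I. \<rho> n powr s)" using M by (subst (asm) mult_le_cancel_left_pos) auto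
  then show ?thesis using I by blast
qed

text \<open>An arbitrary cover is thickened to an open one at total cost \<open>e\<close>. Scale
  \<open>1 / 2\<close> leaves room for the thickened sets to stay of size at most \<open>1\<close>,
  as \<open>open_cover_bound\<close> requires.\<close>

lemma hausdorff_premeasure_limit_set:
  assumes A: "limit_set \<subseteq> A" and s: "0 < s" "real R powr s \<le> M"
  shows "ennreal (1 / (3 * R powr s)) \<le> hausdorff_premeasure s (1 / 2) A"
  unfolding hausdorff_premeasure_def
proof (rule INF_greatest)
  fix U :: "nat \<Rightarrow> real set"
  assume "U \<in> {U. A \<subseteq> (\<Union>n. U n) \<and> (\<forall>n. bounded (U n) \<and> diameter (U n) \<le> 1 / 2)}"
  then have U: "A \<subseteq> (\<Union>n. U n)" "\<And>n. bounded (U n)" "\<And>n. diameter (U n) \<le> 1 / 2" by auto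
  \<comment> \<open>The empty set fits too: its diameter is \<open>0\<close> and
    \<open>0 powr s = 0\<close>.\<close>
  have diam: "diam_powr s (U n) = diameter (U n) powr s" for n
    using s by (simp add: diam_powr_def)
  show "ennreal (1 / (3 * R powr s)) \<le> (\<Sum>n. ennreal (diam_powr s (U n)))"
  proof (rule ennreal_le_epsilon)
    fix e :: real assume e: "0 < e"
    have "\<exists>r. diameter (U n) < r \<and> r \<le> 1 \<and> r powr s \<le> diam_powr s (U n) + e * (1 / 2) ^ Suc n" for n
    proof -
      let ?\<delta> = "diameter (U n)"
      have "((\<lambda>r. r powr s) \<longlongrightarrow> ?\<delta> powr s) (at_right ?\<delta>)"
        using s diameter_ge_0[OF U(2)[of n]]
        by (intro tendsto_powr' tendsto_intros) (auto intro!: eventually_at_rightI[of _ "?\<delta> + 1"])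
      then have "\<forall>\<^sub>F r in at_right ?\<delta>. r powr s < ?\<delta> powr s + e * (1 / 2) ^ Suc n"
        using e by (intro order_tendstoD(2)) auto
      moreover have "\<forall>\<^sub>F r in at_right ?\<delta>. ?\<delta> < r \<and> r \<le> 1"
        using U(3)[of n] by (intro eventually_at_rightI[of _ 1]) auto
      ultimately have "\<forall>\<^sub>F r in at_right ?\<delta>. ?\<delta> < r \<and> r \<le> 1 \<and> r powr s \<le> ?\<delta> powr s + e * (1 / 2) ^ Suc n"
        by eventually_elim auto
      then show ?thesis
        unfolding diam using eventually_happens' trivial_limit_at_right_real by blast
    qed
    then obtain \<rho> where \<rho>: "\<And>n. diameter (U n) < \<rho> n" "\<And>n. \<rho> n \<le> 1"
      "\<And>n. \<rho> n powr s \<le> diam_powr s (U n) + e * (1 / 2) ^ Suc n" by metis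
    \<comment> \<open>Each of two points gains at most half of the slack
      \<open>\<rho> n - diameter (U n)\<close>, so their distance stays below
      \<open>\<rho> n\<close>.\<close>
    define V where "V n = (\<Union>u\<in>U n. ball u ((\<rho> n - diameter (U n)) / 2))" for n
    have "\<exists>I. finite I \<and> 1 \<le> 3 * R powr s * (\<Sum>n\<in>I. \<rho> n powr s)"
    proof (rule open_cover_bound[of V])
      have UV: "u \<in> V n" if "u \<in> U n" for u n
      proof -
        have "u \<in> ball u ((\<rho> n - diameter (U n)) / 2)" using \<rho>(1)[of n] by simp
        then show ?thesis unfolding V_def using that by blast
      qed
      show "limit_set \<subseteq> (\<Union>n. V n)"
      proof
        fix x assume "x \<in> limit_set"
        then obtain n where "x \<in> U n" using A U(1) by blast
        then show "x \<in> (\<Union>n. V n)" using UV by blast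
      qed
      show "open (V n)" for n by (auto simp: V_def)
      show "0 < \<rho> n" for n using \<rho>(1)[of n] diameter_ge_0[OF U(2)[of n]] by simp
      fix n x y assume "x \<in> V n" "y \<in> V n"
      then obtain u u' where u: "u \<in> U n" "dist u x < (\<rho> n - diameter (U n)) / 2"
        "u' \<in> U n" "dist u' y < (\<rho> n - diameter (U n)) / 2" by (auto simp: V_def)
      have "dist u u' \<le> diameter (U n)" using diameter_bounded_bound U(2) u by blast
      then show "\<bar>x - y\<bar> < \<rho> n" using u(2,4)
        unfolding dist_real_def abs_less_iff abs_le_iff by (simp add: field_simps)
    qed (use \<rho> s in auto)
    then obtain I where I: "finite I" "1 \<le> 3 * R powr s * (\<Sum>n\<in>I. \<rho> n powr s)" by blast
    have "0 < 3 * R powr s" using R by simp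
    then have "1 / (3 * R powr s) \<le> (\<Sum>n\<in>I. \<rho> n powr s)"
      using I(2) by (simp only: pos_divide_le_eq mult.commute)
    also have "\<dots> \<le> (\<Sum>n\<in>I. diam_powr s (U n) + e * (1 / 2) ^ Suc n)" by (intro sum_mono \<rho>)
    finally have "ennreal (1 / (3 * R powr s)) \<le> ennreal (\<Sum>n\<in>I. diam_powr s (U n) + e * (1 / 2) ^ Suc n)"
      by (rule ennreal_leI)
    also have "\<dots> = (\<Sum>n\<in>I. ennreal (diam_powr s (U n)) + ennreal (e * (1 / 2) ^ Suc n))"
      using e by (subst sum_ennreal[symmetric]) (auto simp: diam intro!: sum.cong ennreal_plus)
    also have "\<dots> \<le> (\<Sum>n. ennreal (diam_powr s (U n)) + ennreal (e * (1 / 2) ^ Suc n))"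
      using I by (intro sum_le_suminf) auto
    also have "\<dots> = (\<Sum>n. ennreal (diam_powr s (U n))) + (\<Sum>n. ennreal (e * (1 / 2) ^ Suc n))"
      by (intro suminf_add[symmetric]) auto
    also have "(\<Sum>n. ennreal (e * (1 / 2) ^ Suc n)) = ennreal e"
      using sums_mult[OF power_half_series, of e] e by (intro suminf_ennreal_eq) auto
    finally show "ennreal (1 / (3 * R powr s)) \<le> (\<Sum>n. ennreal (diam_powr s (U n))) + ennreal e" .
  qed
qed

end

section \<open>Cantor sets avoiding localized sets\<close>

text \<open>After scaling by \<open>R ^ Suc n\<close> the danger lies within \<open>1 / 2\<close> of
  a point \<open>y\<close>, and a unit cell \<open>[l, l + 1]\<close> reaching it has
  \<open>l\<close> between \<open>y - 3 / 2\<close> and \<open>y + 1 / 2\<close>, a range with at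
  most three integers.\<close>

lemma card_cells_meeting_danger:
  fixes D :: "real set" and R k n :: nat
  assumes R: "R \<ge> 1"
    and z: "\<forall>x \<in> D \<inter> {k / R ^ n..k / R ^ n + 1 / R ^ n}. \<bar>x - z\<bar> \<le> 1 / (2 * real R ^ Suc n)"
  shows "card {l \<in> {R * k..<R * k + R}. {real l / R ^ Suc n..(real l + 1) / R ^ Suc n} \<inter> D \<noteq> {}} \<le> 3"
    (is "card ?B \<le> 3")
proof -
  define y where "y = z * real R ^ Suc n"
  \<comment> \<open>Clipping a negative ceiling to \<open>0\<close> is harmless: \<open>l\<close> is
    natural, and \<open>a + 2\<close> still dominates \<open>y + 1 / 2\<close>.\<close>
  define a where "a = nat \<lceil>y - 3 / 2\<rceil>"
  have "?B \<subseteq> {a..a + 2}"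
  proof
    fix l assume "l \<in> ?B"
    then obtain x where l: "R * k \<le> l" "l + 1 \<le> R * (k + 1)" and x: "x \<in> D"
      "real l / real R ^ Suc n \<le> x" "x \<le> (real l + 1) / real R ^ Suc n" by auto
    define X where "X = x * real R ^ Suc n"
    have Rp: "0 < real R ^ Suc n" using R by (intro zero_less_power) simp
    then have X: "real l \<le> X" "X \<le> real l + 1"
      using x(2,3) unfolding X_def by (simp_all only: pos_divide_le_eq pos_le_divide_eq)
    have "real (R * k) \<le> real l" "real (l + 1) \<le> real (R * (k + 1))" using l by (simp_all only: of_nat_le_iff)
    then have "real (R * k) \<le> X" "X \<le> real (R * (k + 1))" using X by simp_all
    then have "x \<in> {k / R ^ n..k / R ^ n + 1 / R ^ n}"
    proof -
      have "real R * real k \<le> real R * (x * real R ^ n)" "real R * (x * real R ^ n) \<le> real R * (real k + 1)"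
        using \<open>real (R * k) \<le> X\<close> \<open>X \<le> real (R * (k + 1))\<close> by (simp_all add: X_def algebra_simps)
      moreover have "0 < real R" using R by simp
      ultimately have "real k \<le> x * real R ^ n" "x * real R ^ n \<le> real k + 1"
        by (simp_all only: mult_le_cancel_left_pos)
      then show ?thesis using R by (simp add: field_simps)
    qed
    then have "\<bar>x - z\<bar> \<le> 1 / (2 * real R ^ Suc n)" using z x(1) by blast
    then have "\<bar>x - z\<bar> * real R ^ Suc n \<le> 1 / (2 * real R ^ Suc n) * real R ^ Suc n"
      using Rp by (intro mult_right_mono) auto
    also have "\<dots> = 1 / 2" using R by simp
    also have "\<bar>x - z\<bar> * real R ^ Suc n = \<bar>X - y\<bar>"
      unfolding X_def y_def left_diff_distrib[symmetric] using Rp by (simp only: abs_mult abs_of_pos)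
    finally have "\<bar>X - y\<bar> \<le> 1 / 2" .
    then have "y - 3 / 2 \<le> real l" "real l \<le> y + 1 / 2" using X by linarith+
    then show "l \<in> {a..a + 2}" unfolding a_def by simp linarith
  qed
  then have "card ?B \<le> card {a..a + 2}" by (intro card_mono) auto
  then show ?thesis by simp
qed

text \<open>Removing the children that meet \<open>D n\<close> costs each cell of level
  \<open>n\<close> at most three of its \<open>R\<close> children. What survives all levels avoids
  every \<open>D n\<close>.\<close>

lemma hausdorff_premeasure_avoiding_pos:
  fixes D :: "nat \<Rightarrow> real set" and R :: nat
  assumes R: "R \<ge> 4" and s: "0 < s" "real R powr s \<le> real R - 3"
    and loc: "\<And>n a. \<exists>z. \<forall>x \<in> D n \<inter> {a..a + 1 / real R ^ n}. \<bar>x - z\<bar> \<le> 1 / (2 * real R ^ Suc n)"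
    and A: "- (\<Union>n. D n) \<subseteq> A"
  shows "0 < hausdorff_premeasure s (1 / 2) A"
proof -
  let ?cell = "\<lambda>n k. {real k / R ^ n..(real k + 1) / R ^ n}"
  define good where "good n k = {l \<in> {R * k..<R * k + R}. ?cell (Suc n) l \<inter> D n = {}}" for n k
  have "R - 3 \<le> card (good n k)" for n k
  proof -
    let ?B = "{l \<in> {R * k..<R * k + R}. ?cell (Suc n) l \<inter> D n \<noteq> {}}"
    obtain z where "\<forall>x \<in> D n \<inter> {k / R ^ n..k / R ^ n + 1 / R ^ n}. \<bar>x - z\<bar> \<le> 1 / (2 * real R ^ Suc n)"
      using loc[of n "k / R ^ n"] by auto
    then have "card ?B \<le> 3" using card_cells_meeting_danger[of R "D n" k n z] R by simp
    moreover have "good n k \<union> ?B = {R * k..<R * k + R}" by (auto simp: good_def)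
    then have "R \<le> card (good n k) + card ?B"
      using card_Un_le[of "good n k" ?B] by simp
    ultimately show ?thesis by linarith
  qed
  \<comment> \<open>Surplus good children are discarded, since \<open>cantor_tree\<close> wants the
    same number in every cell.\<close>
  then have "\<exists>T \<subseteq> good n k. card T = R - 3" for n k by (meson obtain_subset_with_card_n)
  then obtain C where C: "\<And>n k. C n k \<subseteq> good n k" "\<And>n k. card (C n k) = R - 3" by metis
  define S where "S = rec_nat {0} (\<lambda>n A. \<Union>k\<in>A. C n k)"
  interpret cantor_tree R "R - 3" S C
  proof
    show "C n k \<subseteq> {R * k..<R * k + R}" for n k using C(1)[of n k] by (auto simp: good_def)
  qed (use R C(2) in \<open>auto simp: S_def\<close>)
  have "limit_set \<subseteq> - (\<Union>n. D n)"
  proof (intro subsetI ComplI)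
    fix x assume x: "x \<in> limit_set" "x \<in> (\<Union>n. D n)"
    then obtain n where n: "x \<in> D n" by blast
    have "x \<in> level (Suc n)" using x(1) by (auto simp: limit_set_def)
    then obtain k l where "l \<in> C n k" "x \<in> cell (Suc n) l" by (auto simp: level_def S_Suc)
    then have "cell (Suc n) l \<inter> D n = {}"
      using C(1)[of n k] by (auto simp: good_def cell_def simp del: power_Suc)
    then show False using n \<open>x \<in> cell (Suc n) l\<close> by blast
  qed
  then have "ennreal (1 / (3 * R powr s)) \<le> hausdorff_premeasure s (1 / 2) A"
    using s R A by (intro hausdorff_premeasure_limit_set) auto
  moreover have "0 < ennreal (1 / (3 * R powr s))" using R by simp
  ultimately show ?thesis by (rule less_le_trans[rotated])
qed

text \<open>Once \<open>R powr (1 - s) \<ge> 2\<close>, one has \<open>R powr s \<le> R / 2\<close>,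
  and \<open>R / 2 \<le> R - 3\<close> as soon as \<open>R \<ge> 6\<close>.\<close>

lemma ex_branching_number:
  fixes s :: real
  assumes "s < 1"
  shows "\<exists>R::nat. R \<ge> 6 \<and> real R powr s \<le> real R - 3"
proof -
  obtain m :: nat where m: "2 powr (1 / (1 - s)) \<le> real m" using real_arch_simple by blast
  define R where "R = max 6 m"
  have R6: "R \<ge> 6" and "real m \<le> real R" by (simp_all add: R_def)
  with m have R2: "2 powr (1 / (1 - s)) \<le> real R" by (meson order.trans)
  have "2 \<le> real R powr (1 - s)" using powr_le_swap[OF _ _ R2] assms by simp
  then have "real R powr s * 2 \<le> real R powr s * real R powr (1 - s)" by (intro mult_left_mono) auto
  also have "\<dots> = real R" using R6 by (simp flip: powr_add)
  finally show ?thesis using R6 by (intro exI[of _ R]) auto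
qed

subsection \<open>Simultaneous avoidance\<close>

text \<open>
  Level \<open>n\<close> of the Cantor construction serves the single index \<open>t\<close> with \<open>2 ^ (t - 1)\<close>
  exactly dividing \<open>n + 1\<close>, so that index \<open>t\<close> is served once in every \<open>2 ^ t\<close> levels and its
  windows, of ratio \<open>R ^ 2 ^ t\<close>, tile all heights \<open>q powr (1 + j) \<ge> 1\<close>.
\<close>
definition badness :: "nat \<Rightarrow> real \<Rightarrow> nat \<Rightarrow> real" where
  "badness R j t = (1 / (4 * real R ^ (1 + 2 ^ t))) powr (1 / j)"

text \<open>This is the lower end of a window. Its normalisation makes the upper end equal to
  \<open>R ^ n / 2\<close> and, with \<open>badness\<close> as constant, the radius equal to half
  the length of a cell of level \<open>n + 1\<close>.\<close>

definition window :: "nat \<Rightarrow> nat \<Rightarrow> nat \<Rightarrow> real" where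
  "window R t n = real R ^ Suc n / (2 * real R ^ (1 + 2 ^ t))"

lemma badness_powr:
  assumes "R \<ge> 1" "0 < j"
  shows "badness R j t powr j = 1 / (4 * real R ^ (1 + 2 ^ t))"
  using assms by (simp add: badness_def powr_powr del: power_add)

lemma badness_le:
  assumes "R \<ge> 1" "0 < j" "j < 1"
  shows "badness R j t \<le> 1 / (4 * real R ^ (1 + 2 ^ t))"
proof -
  let ?x = "1 / (4 * real R ^ (1 + 2 ^ t))"
  have "1 \<le> real R ^ (1 + 2 ^ t)" using assms by (intro one_le_power) simp
  then have "0 \<le> ?x" "?x \<le> 1" by (simp_all del: power_Suc add: divide_simps)
  then have "?x powr (1 / j) \<le> ?x powr 1" using assms by (intro powr_mono') auto
  then show ?thesis using \<open>0 \<le> ?x\<close> by (simp add: badness_def)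
qed

text \<open>Interval and two radii together have length at most \<open>2 / R ^ n\<close>, the
  reciprocal of the upper end of the window. The condition of \<open>danger_localized\<close> then
  reduces to \<open>c powr (- i) \<ge> 1\<close>, which follows from \<open>i + j = 1\<close> and
  \<open>badness_le\<close>.\<close>

lemma danger_window_localized:
  assumes d: "\<And>n. n \<ge> 1 \<Longrightarrow> d n \<ge> 2" and R: "R \<ge> 1"
    and ij: "0 < i" "i < 1" "0 < j" "j < 1" "i + j = 1"
  shows "\<exists>z. \<forall>x \<in> danger d i j (badness R j t) (window R t n) (window R t n * real R ^ 2 ^ t)
      \<inter> {a..a + 1 / real R ^ n}. \<bar>x - z\<bar> \<le> 1 / (2 * real R ^ Suc n)"
proof -
  define c P where "c = badness R j t" and "P = real R ^ (1 + 2 ^ t)"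
  have P: "0 < P" using R by (simp add: P_def)
  have c: "0 < c" using R by (simp add: c_def badness_def)
  have cj: "c powr j = 1 / (4 * P)" using badness_powr[of R j t] R ij by (simp add: c_def P_def)
  have lo: "window R t n = real R ^ Suc n / (2 * P)" by (simp add: window_def P_def)
  have hi: "window R t n * real R ^ 2 ^ t = real R ^ n / 2"
    using R by (simp add: window_def power_add)
  have radius: "c powr j / window R t n = 1 / (2 * real R ^ Suc n)"
    unfolding cj lo using P R by simp
  have "4 * P * c \<le> 1" using badness_le[of R j t] R ij P by (simp add: c_def P_def field_simps)
  have "c powr (- i) = c powr j / c"
  proof -
    have i: "- i = j - 1" using ij by simp
    show ?thesis unfolding i powr_diff using c by simp
  qed
  then have ci: "c powr (- i) = 1 / (4 * P * c)" by (simp add: cj)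
  have "1 / real R ^ n + 2 * (c powr j / window R t n) \<le> 2 / real R ^ n"
    unfolding radius using R by (simp add: field_simps)
  also have "\<dots> = 1 / (real R ^ n / 2)" by simp
  also have "\<dots> \<le> c powr (- i) / (real R ^ n / 2)"
    unfolding ci using \<open>4 * P * c \<le> 1\<close> c P by (intro divide_right_mono) auto
  finally have "\<exists>z. \<forall>x \<in> danger d i j c (window R t n) (real R ^ n / 2) \<inter> {a..a + 1 / real R ^ n}.
      \<bar>x - z\<bar> \<le> c powr j / window R t n"
    using d ij c R by (intro danger_localized) (auto simp: window_def)
  then show ?thesis unfolding radius hi c_def[symmetric] .
qed

lemma Bad_if_avoiding_windows:
  assumes R: "R \<ge> 2" and t: "t \<ge> 1" and "0 < j"
    and avoid: "\<And>k. x \<notin> danger d i j (badness R j t) (window R t (2 ^ (t - 1) * (2 * k + 1) - 1))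
       (window R t (2 ^ (t - 1) * (2 * k + 1) - 1) * real R ^ 2 ^ t)"
  shows "x \<in> Bad d i j"
  unfolding Bad_def
proof (intro CollectI exI conjI allI impI)
  show "0 < badness R j t" using R by (simp add: badness_def)
  fix q :: nat assume q: "q \<ge> 1"
  define b :: real where "b = real R ^ 2 ^ t"
  \<comment> \<open>The lower end of the window for \<open>k = 0\<close>. It is at most
    \<open>1\<close>, so no height \<open>q powr (1 + j)\<close> falls below the first
    window.\<close>
  define base where "base = real R ^ 2 ^ (t - 1) / (2 * real R ^ (1 + 2 ^ t))"
  have base: "0 < base" using R by (simp add: base_def)
  have "(2::nat) ^ (t - 1) \<le> 2 ^ t" by (intro power_increasing) auto
  then have "real R ^ 2 ^ (t - 1) \<le> real R ^ (1 + 2 ^ t)"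
    using R by (intro power_increasing trans_le_add2) auto
  then have "base \<le> 1" using R unfolding base_def by (subst divide_le_eq_1_pos) (auto intro: order.trans)
  moreover have "1 \<le> real q powr (1 + j)" using q \<open>0 < j\<close> by (simp add: ge_one_powr_ge_zero)
  ultimately have "1 \<le> real q powr (1 + j) / base" using base by simp
  moreover have "1 < b" using R by (simp add: b_def)
  ultimately obtain k where k: "b ^ k \<le> real q powr (1 + j) / base" "real q powr (1 + j) / base < b ^ Suc k"
    using ex_power_interval by blast
  define n :: nat where "n = 2 ^ (t - 1) * (2 * k + 1) - 1"
  \<comment> \<open>Levels serving \<open>t\<close> are \<open>2 ^ t\<close> apart, so consecutive
    windows differ by the factor \<open>b\<close>, which is also the ratio of their ends: they tile
    without gaps.\<close>
  have "Suc n = 2 ^ (t - 1) + 2 ^ t * k" using t by (cases t) (auto simp: n_def algebra_simps)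
  then have w: "window R t n = base * b ^ k"
    by (simp add: window_def base_def b_def power_add power_mult del: power_Suc)
  have "window R t n \<le> real q powr (1 + j)" "real q powr (1 + j) < window R t n * b"
    unfolding w using k base by (simp_all add: field_simps)
  then show "badness R j t / real q < max (Dnorm d q powr (1 / i)) (infdist (real q * x) \<int> powr (1 / j))"
    using avoid[of k] q unfolding n_def[symmetric] b_def[symmetric] by (auto simp: danger_def not_le)
qed

theorem theorem2:
  fixes d :: "nat \<Rightarrow> nat \<Rightarrow> nat" and i j :: "nat \<Rightarrow> real"
  assumes "\<And>t n. t \<ge> 1 \<Longrightarrow> n \<ge> 1 \<Longrightarrow> d t n \<ge> 2"
    and "\<And>t. t \<ge> 1 \<Longrightarrow> bdd_above (d t ` {1..})"
    and "\<And>t. t \<ge> 1 \<Longrightarrow> 0 < i t \<and> i t < 1 \<and> 0 < j t \<and> j t < 1 \<and> i t + j t = 1"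
  shows "hausdorff_dim (\<Inter>t\<in>{1..}. Bad (d t) (i t) (j t)) = 1"
proof (rule antisym)
  show "hausdorff_dim (\<Inter>t\<in>{1..}. Bad (d t) (i t) (j t)) \<le> 1" by (rule hausdorff_dim_real_le_1)
  have "ennreal 1 \<le> hausdorff_dim (\<Inter>t\<in>{1..}. Bad (d t) (i t) (j t))"
  proof (rule hausdorff_dim_ge)
    fix s :: real assume s: "s < 1" "0 < s"
    obtain R :: nat where R: "R \<ge> 6" "real R powr s \<le> real R - 3" using ex_branching_number s(1) by blast
    \<comment> \<open>The index served at level \<open>n\<close>: every level serves one index, and
      each \<open>t \<ge> 1\<close> is served at the levels where \<open>n + 1\<close> is an odd
      multiple of \<open>2 ^ (t - 1)\<close>.\<close>
    define \<tau> :: "nat \<Rightarrow> nat" where "\<tau> n = Suc (multiplicity 2 (Suc n))" for n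
    define D where "D n = (let t = \<tau> n in danger (d t) (i t) (j t) (badness R (j t) t)
        (window R t n) (window R t n * real R ^ 2 ^ t))" for n
    have \<tau>: "\<tau> (2 ^ (t - 1) * (2 * k + 1) - 1) = t" if "t \<ge> 1" for t k
    proof -
      have "multiplicity 2 (2 ^ (t - 1) * (2 * k + 1)) = t - 1"
      proof (rule multiplicity_eqI)
        show "\<not> 2 ^ Suc (t - 1) dvd 2 ^ (t - 1) * (2 * k + 1)"
          unfolding power_Suc2 by (subst dvd_times_left_cancel_iff) auto
      qed auto
      then show ?thesis using that by (simp add: \<tau>_def)
    qed
    have "0 < hausdorff_premeasure s (1 / 2) (\<Inter>t\<in>{1..}. Bad (d t) (i t) (j t))"
    proof (rule hausdorff_premeasure_avoiding_pos)
      fix n a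
      have "\<tau> n \<ge> 1" by (simp add: \<tau>_def)
      then show "\<exists>z. \<forall>x \<in> D n \<inter> {a..a + 1 / real R ^ n}. \<bar>x - z\<bar> \<le> 1 / (2 * real R ^ Suc n)"
        unfolding D_def Let_def using assms(1,3) R by (intro danger_window_localized) auto
    next
      show "- (\<Union>n. D n) \<subseteq> (\<Inter>t\<in>{1..}. Bad (d t) (i t) (j t))"
      proof (intro subsetI INT_I)
        fix x t assume x: "x \<in> - (\<Union>n. D n)" and "t \<in> {1::nat..}"
        then have t: "t \<ge> 1" by simp
        show "x \<in> Bad (d t) (i t) (j t)"
        proof (rule Bad_if_avoiding_windows[of R t])
          fix k
          have "x \<notin> D (2 ^ (t - 1) * (2 * k + 1) - 1)" using x by blast
          then show "x \<notin> danger (d t) (i t) (j t) (badness R (j t) t)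
              (window R t (2 ^ (t - 1) * (2 * k + 1) - 1))
              (window R t (2 ^ (t - 1) * (2 * k + 1) - 1) * real R ^ 2 ^ t)"
            unfolding D_def Let_def \<tau>[OF t] .
        qed (use R t assms(3) in auto)
      qed
    qed (use R s in auto)
    then show "\<exists>\<delta>. 0 < \<delta> \<and> \<delta> \<le> 1 \<and> 0 < hausdorff_premeasure s \<delta> (\<Inter>t\<in>{1..}. Bad (d t) (i t) (j t))"
      by (intro exI[of _ "1 / 2"]) auto
  qed simp
  then show "1 \<le> hausdorff_dim (\<Inter>t\<in>{1..}. Bad (d t) (i t) (j t))" by simp
qed

end
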